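(* Let $f$ be a probability density function on $(0,\infty)$, let $\delta,\theta>0$ and put $k=\delta/\theta$. Then $f$ is doubly symmetric with constants $\delta$ (for log-symmetry) and $\theta$ (for R-symmetry) if and only if $k>1$ and there exist a constant $C>0$ and a nonnegative measurable function $\omega$ on $(k^{-4},1]$ such that, for all $y>0$, $$f(y)=C\sum_{i=-\infty}^{\infty}\theta^{-2i}\,k^{2i(i+1)}\,y^{2i+1}\,\omega\!\left(\theta^{-2}k^{4(i-1)}y^2\right) I\!\left(\theta k^{-2i}<y\le\theta k^{2-2i}\right),$$ and such that the function $\psi(u)=u\,\omega(u)$ satisfies $$\psi(u)=\psi\!\left(\frac{1}{k^4u}\right)\qquad\text{for } k^{-4}<u<1.$$
   Context: A probability density $f$ on $(0,\infty)$ is log-symmetric with constant $\delta>0$ if $y^2 f(\delta y)=f(\delta/y)$ for all $y>0$. It is R-symmetric with constant $\theta>0$ if $f(\theta y)=f(\theta/y)$ for all $y>0$. It is doubly symmetric with constants $\delta$ and $\theta$ if both properties hold. $I(\cdot)$ denotes the indicator of the stated condition; for each $y>0$ exactly one term of the sum has nonzero indicator, and that term is the only one in which $\omega$ is evaluated (the other terms are taken to be $0$). *)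

theory Defs
  imports "HOL-Analysis.Analysis"
begin

text \<open>Densities on the positive half-line are functions \<open>real \<Rightarrow> real\<close> of which only the values
  at positive arguments matter. Measurability is Borel measurability.\<close>

definition pos_density :: "(real \<Rightarrow> real) \<Rightarrow> bool" where
  "pos_density f \<longleftrightarrow>
     f \<in> borel_measurable (restrict_space borel {0<..}) \<and>
     (\<forall>y>0. 0 \<le> f y) \<and>
     (\<integral>\<^sup>+ y\<in>{0<..}. ennreal (f y) \<partial>lborel) = 1"

definition log_symmetric :: "(real \<Rightarrow> real) \<Rightarrow> real \<Rightarrow> bool" where
  "log_symmetric f \<delta> \<longleftrightarrow> 0 < \<delta> \<and> (\<forall>y>0. y\<^sup>2 * f (\<delta> * y) = f (\<delta> / y))"

definition R_symmetric :: "(real \<Rightarrow> real) \<Rightarrow> real \<Rightarrow> bool" where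
  "R_symmetric f \<theta> \<longleftrightarrow> 0 < \<theta> \<and> (\<forall>y>0. f (\<theta> * y) = f (\<theta> / y))"

definition doubly_symmetric :: "(real \<Rightarrow> real) \<Rightarrow> real \<Rightarrow> real \<Rightarrow> bool" where
  "doubly_symmetric f \<delta> \<theta> \<longleftrightarrow> log_symmetric f \<delta> \<and> R_symmetric f \<theta>"

end

theory Submission
  imports Defs
begin

text \<open>Composing the two symmetries gives \<open>f (x / k\<^sup>2) = (x / \<delta>)\<^sup>2 f x\<close>. For a density this scaling law
  forces the moments \<open>E X\<^sup>2 = \<delta>\<^sup>2 k\<^sup>2 =: c\<close> and \<open>E X\<^sup>4 = \<delta>\<^sup>4 k\<^sup>8\<close>, so that
  \<open>E (X\<^sup>2 - c)\<^sup>2 = \<delta>\<^sup>4 k\<^sup>4 (k\<^sup>4 - 1)\<close> must be positive, whence \<open>k > 1\<close>.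
  When \<open>k > 1\<close>, every \<open>y > 0\<close> is uniquely \<open>\<theta> k\<^bsup>2m\<^esup> v\<close> with \<open>m\<close> an integer and \<open>k\<^bsup>-2\<^esup> < v \<le> 1\<close>. In these
  coordinates the series collapses to \<open>\<theta> k\<^bsup>4-2m\<^sup>2\<^esup> v\<^bsup>3-2m\<^esup> \<omega> (v\<^sup>2)\<close>, the scaling law becomes the shift
  \<open>m \<mapsto> m + 1\<close>, and R-symmetry becomes the condition on \<open>\<psi>\<close>.\<close>

section \<open>The series in layer coordinates\<close>

definition layer_sum :: "real \<Rightarrow> real \<Rightarrow> (real \<Rightarrow> real) \<Rightarrow> real \<Rightarrow> real" where
  "layer_sum \<theta> k \<omega> y = (\<Sum>\<^sub>\<infinity>i::int.
     if \<theta> * k powi (-2 * i) < y \<and> y \<le> \<theta> * k powi (2 - 2 * i)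
     then \<theta> powi (-2 * i) * k powi (2 * i * (i + 1)) * y powi (2 * i + 1)
            * \<omega> (\<theta> powi (-2) * k powi (4 * (i - 1)) * y\<^sup>2)
     else 0)"

text \<open>In logarithms of \<open>k\<close>, \<open>v\<close> and \<theta> the indicator
  conditions become linear inequalities. As \<open>-2 * a < b\<close> and \<open>b \<le> 0\<close>,
  they leave only the index \<open>1 - m\<close>, and the powers combine by adding
  exponents.\<close>

lemma layer_sum_eval:
  fixes \<theta> k v :: real
  assumes k: "k > 1" and \<theta>: "\<theta> > 0" and v: "k powi (-2) < v" "v \<le> 1"
  shows "layer_sum \<theta> k \<omega> (\<theta> * k powi (2 * m) * v)
           = \<theta> * k powi (4 - 2 * m\<^sup>2) * v powi (3 - 2 * m) * \<omega> (v\<^sup>2)"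
proof -
  have v0: "v > 0" using v(1) k by (smt (verit) zero_less_power_int)
  obtain a b c where abc: "k = exp a" "v = exp b" "\<theta> = exp c"
    using k \<theta> v0 by (metis exp_ln less_trans zero_less_one)
  have a: "a > 0" using k abc by simp
  have b: "-2 * a < b" "b \<le> 0" using v by (simp_all add: abc exp_power_int)
  define y where "y = \<theta> * k powi (2 * m) * v"
  have y: "y = exp (c + 2 * m * a + b)"
    by (simp add: y_def abc exp_power_int exp_add)
  have iff: "\<theta> * k powi (-2 * i) < y \<and> y \<le> \<theta> * k powi (2 - 2 * i) \<longleftrightarrow> i = 1 - m" for i :: int
  proof -
    have "\<theta> * k powi (-2 * i) < y \<and> y \<le> \<theta> * k powi (2 - 2 * i)
            \<longleftrightarrow> - 2 * i * a < 2 * m * a + b \<and> 2 * m * a + b \<le> (2 - 2 * i) * a"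
      by (simp add: y abc exp_power_int flip: exp_add)
    also have "\<dots> \<longleftrightarrow> i = 1 - m"
    proof
      assume *: "- 2 * i * a < 2 * m * a + b \<and> 2 * m * a + b \<le> (2 - 2 * i) * a"
      have "real_of_int (- i) * a < real_of_int m * a"
        using * b by (simp add: algebra_simps)
      hence "- i < m" using a by (metis mult_less_cancel_right_pos of_int_less_iff)
      moreover have "real_of_int (m - 1) * a < real_of_int (1 - i) * a"
        using * b by (simp add: algebra_simps)
      hence "m - 1 < 1 - i" using a by (metis mult_less_cancel_right_pos of_int_less_iff)
      ultimately show "i = 1 - m" by simp
    next
      assume "i = 1 - m"
      thus "- 2 * i * a < 2 * m * a + b \<and> 2 * m * a + b \<le> (2 - 2 * i) * a"
        using b by (simp only:) (simp add: algebra_simps)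
    qed
    finally show ?thesis .
  qed
  have "\<theta> powi (-2) * k powi (4 * (1 - m - 1)) * y\<^sup>2 = v\<^sup>2"
    by (simp add: y abc exp_power_int algebra_simps flip: exp_add exp_of_nat_mult exp_double)
  moreover have "\<theta> powi (-2 * (1 - m)) * k powi (2 * (1 - m) * (1 - m + 1)) * y powi (2 * (1 - m) + 1)
        = \<theta> * k powi (4 - 2 * m\<^sup>2) * v powi (3 - 2 * m)"
    by (simp add: y abc exp_power_int flip: exp_add)
      (simp add: algebra_simps power2_eq_square)
  \<comment> \<open>The finite support gives a genuine \<open>has_sum\<close>, so the value is not
    the default 0 of a non-summable family.\<close>
  ultimately show ?thesis
    unfolding layer_sum_def y_def[symmetric] iff
    by (intro infsumI has_sum_finite_neutralI[where B = "{1 - m}"]) simp_all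
qed

lemma layer_coords:
  fixes k z :: real
  assumes k: "k > 1" and z: "z > 0"
  obtains m :: int and v where "z = k powi (2 * m) * v" "k powi (-2) < v" "v \<le> 1" "v > 0"
proof -
  \<comment> \<open>The ceiling, not the floor, makes the range of \<open>v\<close> closed at 1 and
    open at \<open>k powi (-2)\<close>, as in the layers of the series.\<close>
  define t m where "t = ln z / (2 * ln k)" and "m = \<lceil>t\<rceil>"
  have a: "ln k > 0" using k by simp
  have zt: "z = exp (2 * ln k * t)" using a z by (simp add: t_def)
  have kp: "k powi n = exp (n * ln k)" for n :: int
    using k by (simp flip: exp_power_int)
  have m: "m - 1 < t" "t \<le> m" unfolding m_def by linarith+
  have "ln k * (m - 1) < ln k * t" "ln k * t \<le> ln k * m"
    using m a by (simp_all only: mult_less_cancel_left_pos mult_le_cancel_left_pos)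
  then show thesis
    by (intro that[of m "exp (2 * ln k * t - 2 * m * ln k)"])
      (use m a in \<open>simp_all add: zt kp algebra_simps flip: exp_add\<close>)
qed

section \<open>The scaling law\<close>

text \<open>In logarithmic coordinates each step from \<open>x\<close> to \<open>2 * a + x\<close>
  contributes the exponent \<open>-(2 * a + 2 * x)\<close>. Summing this along the arithmetic
  progression from \<open>b\<close> gives the exponent quadratic in \<open>m\<close>; negative
  \<open>m\<close> comes from stepping backwards.\<close>

lemma scaling_iterate:
  fixes g :: "real \<Rightarrow> real" and k y :: real and m :: int
  assumes k: "k > 0"
    and g: "\<And>x. x > 0 \<Longrightarrow> g x = k\<^sup>2 * x\<^sup>2 * g (k\<^sup>2 * x)"
    and y: "y > 0"
  shows "g (k powi (2 * m) * y) = k powi (- 2 * m\<^sup>2) * y powi (- 2 * m) * g y"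
proof -
  obtain a b where ab: "k = exp a" "y = exp b" using k y by (metis exp_ln)
  have step: "g (exp x) = exp (2 * a + 2 * x) * g (exp (2 * a + x))" for x
    using g[of "exp x"] by (simp add: ab exp_add exp_double)
  have "g (exp (2 * m * a + b)) = exp (- 2 * m\<^sup>2 * a - 2 * m * b) * g (exp b)"
  proof (induction m rule: int_induct[where k = 0])
    case base
    show ?case by simp
  next
    case (step1 m)
    have "g (exp (2 * (m + 1) * a + b))
        = exp (- (2 * a + 2 * (2 * m * a + b))) * g (exp (2 * m * a + b))"
      using step[of "2 * m * a + b"]
      by (simp add: distrib_left distrib_right add.assoc flip: exp_add mult.assoc)
        (simp add: add_ac)
    then show ?case
      unfolding step1.IH mult.assoc[symmetric] exp_add[symmetric]
      by (simp add: algebra_simps power2_eq_square)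
  next
    case (step2 m)
    have "g (exp (2 * (m - 1) * a + b))
        = exp (2 * a + 2 * (2 * (m - 1) * a + b)) * g (exp (2 * m * a + b))"
      using step[of "2 * (m - 1) * a + b"] by (simp add: algebra_simps)
    then show ?case
      unfolding step2.IH mult.assoc[symmetric] exp_add[symmetric]
      by (simp add: algebra_simps power2_eq_square)
  qed
  then show ?thesis
    by (simp add: ab exp_power_int flip: exp_add)
qed

text \<open>R-symmetry at \<open>y / k\<close> replaces \<open>f (\<delta> / y)\<close> by
  \<open>f (\<theta> * (y / k))\<close>. Log-symmetry then contains no reciprocal, and the
  substitution \<open>y = k * x\<close> turns it into the scaling law.\<close>

lemma doubly_symmetric_iff_scaling:
  fixes f :: "real \<Rightarrow> real"
  assumes "\<delta> > 0" "\<theta> > 0" "k = \<delta> / \<theta>"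
  shows "doubly_symmetric f \<delta> \<theta> \<longleftrightarrow> R_symmetric f \<theta> \<and>
           (\<forall>x>0. f (\<theta> * x) = k\<^sup>2 * x\<^sup>2 * f (\<theta> * (k\<^sup>2 * x)))"
proof -
  have k: "k > 0" and \<delta>: "\<delta> = \<theta> * k" using assms by auto
  have "log_symmetric f \<delta> \<longleftrightarrow> (\<forall>x>0. f (\<theta> * x) = k\<^sup>2 * x\<^sup>2 * f (\<theta> * (k\<^sup>2 * x)))"
    if R: "R_symmetric f \<theta>"
  proof -
    have R: "f (\<delta> / y) = f (\<theta> * (y / k))" if "y > 0" for y
      using R k that unfolding R_symmetric_def \<delta>
      by (metis divide_divide_eq_right divide_pos_pos times_divide_eq_right)
    have "log_symmetric f \<delta> \<longleftrightarrow> (\<forall>y>0. y\<^sup>2 * f (\<delta> * y) = f (\<theta> * (y / k)))"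
      using R assms(1) by (simp add: log_symmetric_def)
    also have "\<dots> \<longleftrightarrow> (\<forall>x>0. (k * x)\<^sup>2 * f (\<delta> * (k * x)) = f (\<theta> * x))"
    proof safe
      fix x :: real assume *: "\<forall>y>0. y\<^sup>2 * f (\<delta> * y) = f (\<theta> * (y / k))" "x > 0"
      show "(k * x)\<^sup>2 * f (\<delta> * (k * x)) = f (\<theta> * x)"
        using *(1)[rule_format, of "k * x"] *(2) k by simp
    next
      fix y :: real assume *: "\<forall>x>0. (k * x)\<^sup>2 * f (\<delta> * (k * x)) = f (\<theta> * x)" "y > 0"
      show "y\<^sup>2 * f (\<delta> * y) = f (\<theta> * (y / k))"
        using *(1)[rule_format, of "y / k"] *(2) k by simp
    qed
    also have "\<dots> \<longleftrightarrow> (\<forall>x>0. f (\<theta> * x) = k\<^sup>2 * x\<^sup>2 * f (\<theta> * (k\<^sup>2 * x)))"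
      by (auto simp: \<delta> power2_eq_square mult_ac)
    finally show ?thesis .
  qed
  then show ?thesis by (auto simp: doubly_symmetric_def)
qed

section \<open>Moments force k > 1\<close>

lemma scaling_density_gt_1:
  fixes f :: "real \<Rightarrow> real" and \<theta> k :: real
  assumes dens: "pos_density f" and \<theta>: "\<theta> > 0" and k: "k > 0"
    and scal: "\<And>x. x > 0 \<Longrightarrow> f (\<theta> * x) = k\<^sup>2 * x\<^sup>2 * f (\<theta> * (k\<^sup>2 * x))"
  shows "k > 1"
proof (rule ccontr)
  assume "\<not> k > 1"
  hence k1: "k \<le> 1" by simp
  \<comment> \<open>Measuring in units of \<theta> removes it from the scaling law. Extending by 0
    allows affine substitution in integrals over the whole line.\<close>
  define g where "g x = (if x > 0 then f (\<theta> * x) else 0)" for x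
  define F where "F x = indicator {0<..} x * f x" for x
  have F_meas: "F \<in> borel_measurable borel"
    using dens unfolding pos_density_def F_def
    by (simp add: borel_measurable_restrict_space_iff)
  have F_nn: "F x \<ge> 0" for x
    using dens by (auto simp: F_def pos_density_def indicator_def)
  have gF: "g = (\<lambda>x. F (0 + \<theta> * x))"
    using \<theta> by (auto simp: g_def F_def indicator_def zero_less_mult_iff)
  have g_meas [measurable]: "g \<in> borel_measurable borel"
    unfolding gF using F_meas by measurable
  have g_nn: "g x \<ge> 0" for x by (simp add: gF F_nn)
  have "(\<integral>\<^sup>+ x. ennreal (F x) \<partial>lborel) = (\<integral>\<^sup>+ y\<in>{0<..}. ennreal (f y) \<partial>lborel)"
    by (intro nn_integral_cong) (auto simp: F_def indicator_def)
  hence F1: "(\<integral>\<^sup>+ x. ennreal (F x) \<partial>lborel) = 1" using dens by (simp add: pos_density_def)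
  have F_int: "integrable lborel F"
    using F1 F_meas F_nn by (intro integrableI_nonneg) auto
  have g_int: "integrable lborel g"
    unfolding gF using F_int \<theta> by (intro lborel_integrable_real_affine) auto
  define M where "M = (\<integral>x. g x \<partial>lborel)"
  have "(\<integral>x. F x \<partial>lborel) = 1" using F1 F_meas F_nn by (simp add: integral_eq_nn_integral)
  hence M: "M > 0"
    using lborel_integral_real_affine[of \<theta> F 0] \<theta>
    by (simp add: M_def gF) (metis mult_zero_right zero_less_mult_pos zero_less_one)
  have g_scal: "x\<^sup>2 * g (k\<^sup>2 * x) = g x / k\<^sup>2" for x
    using scal[of x] k by (auto simp: g_def zero_less_mult_iff)
  have kk: "k\<^sup>2 \<noteq> 0" using k by simp
  \<comment> \<open>The scaling law turns \<open>x\<^sup>2 g x\<close> into \<open>g\<close> itself at a rescaled argument, which gives integrability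
    together with the value of each moment.\<close>
  have g2: "(k\<^sup>2 * x)\<^sup>2 * g (k\<^sup>2 * x) = k\<^sup>2 * g x" for x
  proof -
    have "(k\<^sup>2 * x)\<^sup>2 * g (k\<^sup>2 * x) = k^4 * (x\<^sup>2 * g (k\<^sup>2 * x))"
      by (simp add: eval_nat_numeral)
    thus ?thesis unfolding g_scal using k by (simp add: eval_nat_numeral)
  qed
  have g4: "(k\<^sup>2 * x)^4 * g (k\<^sup>2 * x) = k^6 * (x\<^sup>2 * g x)" for x
  proof -
    have "(k\<^sup>2 * x)^4 * g (k\<^sup>2 * x) = k^8 * x\<^sup>2 * (x\<^sup>2 * g (k\<^sup>2 * x))"
      by (simp add: eval_nat_numeral)
    thus ?thesis unfolding g_scal using k by (simp add: eval_nat_numeral)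
  qed
  note affine_integrable = lborel_integrable_real_affine_iff[OF kk, where t = 0, unfolded add_0_left]
  note affine_integral = lborel_integral_real_affine[OF kk, where t = 0, unfolded add_0_left]
  have i2: "integrable lborel (\<lambda>x. x\<^sup>2 * g x)"
    using g_int affine_integrable[of "\<lambda>x. x\<^sup>2 * g x"] by (simp add: g2)
  have m2: "(\<integral>x. x\<^sup>2 * g x \<partial>lborel) = k^4 * M"
    using affine_integral[of "\<lambda>x. x\<^sup>2 * g x"] by (simp add: g2 M_def flip: mult.assoc power_add)
  have i4: "integrable lborel (\<lambda>x. x^4 * g x)"
    using i2 affine_integrable[of "\<lambda>x. x^4 * g x"] by (simp add: g4)
  have m4: "(\<integral>x. x^4 * g x \<partial>lborel) = k^12 * M"
    using affine_integral[of "\<lambda>x. x^4 * g x"] by (simp add: g4 m2)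
  \<comment> \<open>The centre \<open>k^4\<close> is the second moment divided by the mass
    \<open>M\<close>, so the integral is \<open>M\<close> times the variance of the squared
    variable. For \<open>k \<le> 1\<close> the computed value is nonpositive although the integrand
    is nonnegative.\<close>
  have expand: "(x\<^sup>2 - k^4)\<^sup>2 * g x = x^4 * g x - 2 * k^4 * (x\<^sup>2 * g x) + k^8 * g x" for x
    by (simp add: power2_eq_square eval_nat_numeral algebra_simps)
  have int_sq: "integrable lborel (\<lambda>x. (x\<^sup>2 - k^4)\<^sup>2 * g x)"
    unfolding expand using i2 i4 g_int by simp
  have "(\<integral>x. (x\<^sup>2 - k^4)\<^sup>2 * g x \<partial>lborel) = k^12 * M - 2 * k^4 * (k^4 * M) + k^8 * M"
    unfolding expand using i2 i4 g_int by (simp add: m2 m4 M_def)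
  also have "\<dots> = k^8 * (k^4 - 1) * M"
    by (simp add: algebra_simps eval_nat_numeral)
  also have "\<dots> \<le> 0"
    using k k1 M by (intro mult_nonpos_nonneg mult_nonneg_nonpos) (auto simp: power_le_one)
  finally have "(\<integral>x. (x\<^sup>2 - k^4)\<^sup>2 * g x \<partial>lborel) = 0"
    using g_nn by (intro antisym) auto
  hence "AE x in lborel. (x\<^sup>2 - k^4)\<^sup>2 * g x = 0"
    using int_sq g_nn by (subst (asm) integral_nonneg_eq_0_iff_AE) auto
  \<comment> \<open>The vanishing integral leaves \<open>g\<close> free only at the positive root of
    \<open>x^2 = k^4\<close>, which is a null set. This also disposes of the borderline case
    \<open>k = 1\<close>.\<close>
  moreover have "AE x in lborel. x \<noteq> k\<^sup>2" by (rule AE_lborel_singleton)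
  ultimately have "AE x in lborel. g x = 0"
  proof eventually_elim
    case (elim x)
    have "x\<^sup>2 \<noteq> k^4" if "x > 0"
    proof
      assume "x\<^sup>2 = k^4"
      hence "x\<^sup>2 = (k\<^sup>2)\<^sup>2" by simp
      from power2_eq_imp_eq[OF this] show False using that elim(2) by simp
    qed
    thus ?case using elim(1) by (cases "x > 0") (auto simp: g_def)
  qed
  hence "M = 0" unfolding M_def by (intro integral_eq_zero_AE)
  with M show False by simp
qed

section \<open>Both directions of the representation\<close>

lemma representation_imp_symmetric:
  fixes f \<omega> :: "real \<Rightarrow> real" and \<theta> k C :: real
  assumes k: "k > 1" and \<theta>: "\<theta> > 0"
    and f: "\<And>y. y > 0 \<Longrightarrow> f y = C * layer_sum \<theta> k \<omega> y"
    and psi: "\<And>u. k powi (-4) < u \<Longrightarrow> u < 1 \<Longrightarrow> u * \<omega> u = 1 / (k ^ 4 * u) * \<omega> (1 / (k ^ 4 * u))"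
  shows "R_symmetric f \<theta>" "x > 0 \<Longrightarrow> f (\<theta> * x) = k\<^sup>2 * x\<^sup>2 * f (\<theta> * (k\<^sup>2 * x))"
proof -
  have val: "f (\<theta> * (k powi (2 * m) * v)) = C * (\<theta> * k powi (4 - 2 * m\<^sup>2) * v powi (3 - 2 * m) * \<omega> (v\<^sup>2))"
    if "k powi (-2) < v" "v \<le> 1" "v > 0" for m v
    using f[of "\<theta> * k powi (2 * m) * v"] layer_sum_eval[OF k \<theta> that(1,2)] k \<theta> that(3)
    by (simp add: mult.assoc)
  show "R_symmetric f \<theta>"
    unfolding R_symmetric_def
  proof (intro conjI allI impI \<theta>)
    fix y :: real assume "y > 0"
    then obtain m v where y: "y = k powi (2 * m) * v" and v: "k powi (-2) < v" "v \<le> 1" "v > 0"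
      using layer_coords[OF k] by metis
    \<comment> \<open>Inversion sends \<open>(m, v)\<close> to \<open>(1 - m, 1 / (k^2 * v))\<close>
      when \<open>v < 1\<close>. At \<open>v = 1\<close> that second coordinate would hit the
      excluded endpoint; there inversion is \<open>m\<close> to \<open>-m\<close>, and evenness of
      the exponent in \<open>m\<close> suffices.\<close>
    show "f (\<theta> * y) = f (\<theta> / y)"
    proof (cases "v = 1")
      case True
      have "\<theta> / y = \<theta> * (k powi (2 * - m) * 1)"
        by (simp add: y True power_int_minus field_simps)
      thus ?thesis using val[of 1 m] val[of 1 "- m"] v True y by simp
    next
      case False
      define w where "w = 1 / (k\<^sup>2 * v)"
      have w: "k powi (-2) < w" "w \<le> 1" "w > 0" "w\<^sup>2 = 1 / (k ^ 4 * v\<^sup>2)"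
        using v False k by (auto simp: w_def field_simps power_int_minus power_mult_distrib
            simp flip: power_mult)
      have "k powi (-4) < v\<^sup>2"
      proof -
        have "(k powi (-2))\<^sup>2 < v\<^sup>2" using v(1) k by (intro power_strict_mono) auto
        thus ?thesis by (simp add: power_int_minus power_inverse flip: power_mult)
      qed
      moreover have "v\<^sup>2 < 1" using v False by (simp add: power_less_one_iff)
      ultimately have om: "\<omega> (w\<^sup>2) = k ^ 4 * v ^ 4 * \<omega> (v\<^sup>2)"
        using psi[of "v\<^sup>2"] v k by (simp add: w(4) field_simps flip: power_add)
      have yw: "\<theta> / y = \<theta> * (k powi (2 * (1 - m)) * w)"
        using k by (simp add: y w_def power_int_diff right_diff_distrib)
      obtain a b where ab: "k = exp a" "v = exp b" using k v by (metis exp_ln less_trans zero_less_one)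
      have "k powi (4 - 2 * (1 - m)\<^sup>2) * w powi (3 - 2 * (1 - m)) * (k ^ 4 * v ^ 4)
              = k powi (4 - 2 * m\<^sup>2) * v powi (3 - 2 * m)"
      proof -
        have "w = exp (- 2 * a - b)"
          by (simp add: w_def ab exp_diff exp_minus field_simps exp_double[symmetric])
        moreover have "k ^ 4 = exp (4 * a)" "v ^ 4 = exp (4 * b)"
          by (simp_all add: ab flip: exp_of_nat_mult)
        ultimately show ?thesis
          unfolding ab by (simp add: exp_power_int flip: exp_add)
            (simp add: algebra_simps power2_eq_square)
      qed
      hence "f (\<theta> / y) = C * (\<theta> * (k powi (4 - 2 * m\<^sup>2) * v powi (3 - 2 * m)) * \<omega> (v\<^sup>2))"
        unfolding yw val[OF w(1-3)] om by (metis mult.assoc)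
      thus ?thesis by (simp add: y val[OF v] mult.assoc)
    qed
  qed
  show "f (\<theta> * x) = k\<^sup>2 * x\<^sup>2 * f (\<theta> * (k\<^sup>2 * x))" if "x > 0"
  proof -
    obtain m v where x: "x = k powi (2 * m) * v" and v: "k powi (-2) < v" "v \<le> 1" "v > 0"
      using layer_coords[OF k \<open>x > 0\<close>] by metis
    have kx: "k\<^sup>2 * x = k powi (2 * (m + 1)) * v"
      using k by (simp add: x distrib_left power_int_add)
    \<comment> \<open>The shift changes the exponent of \<open>k\<close> by
      \<open>-4 * m - 2\<close> and that of \<open>v\<close> by \<open>-2\<close>, exactly cancelled
      by \<open>k^2 * x^2\<close>.\<close>
    obtain a b where ab: "k = exp a" "v = exp b" using k v by (metis exp_ln less_trans zero_less_one)
    have "k\<^sup>2 * x\<^sup>2 * (k powi (4 - 2 * (m + 1)\<^sup>2) * v powi (3 - 2 * (m + 1)))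
            = k powi (4 - 2 * m\<^sup>2) * v powi (3 - 2 * m)"
      by (simp add: x ab exp_power_int flip: exp_add exp_double)
        (simp add: algebra_simps power2_eq_square)
    then have "f (\<theta> * x) = C * (\<theta> * (k\<^sup>2 * x\<^sup>2 * (k powi (4 - 2 * (m + 1)\<^sup>2) * v powi (3 - 2 * (m + 1)))) * \<omega> (v\<^sup>2))"
      unfolding x val[OF v] by (simp add: mult.assoc)
    thus ?thesis unfolding kx val[OF v] by (simp add: mult_ac)
  qed
qed

lemma symmetric_imp_representation:
  fixes f :: "real \<Rightarrow> real" and \<theta> k :: real
  assumes dens: "pos_density f" and k: "k > 1" and \<theta>: "\<theta> > 0"
    and R: "R_symmetric f \<theta>"
    and scal: "\<And>x. x > 0 \<Longrightarrow> f (\<theta> * x) = k\<^sup>2 * x\<^sup>2 * f (\<theta> * (k\<^sup>2 * x))"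
  obtains \<omega> :: "real \<Rightarrow> real" where
    "\<omega> \<in> borel_measurable (restrict_space borel {k powi (-4)<..1})"
    "\<And>u. u \<in> {k powi (-4)<..1} \<Longrightarrow> 0 \<le> \<omega> u"
    "\<And>y. y > 0 \<Longrightarrow> f y = layer_sum \<theta> k \<omega> y"
    "\<And>u. k powi (-4) < u \<Longrightarrow> u < 1 \<Longrightarrow> u * \<omega> u = 1 / (k ^ 4 * u) * \<omega> (1 / (k ^ 4 * u))"
proof
  \<comment> \<open>This solves the layer formula at \<open>m = 0\<close>, namely
    \<open>f (\<theta> * v) = \<theta> * k^4 * v^3 * \<omega> (v^2)\<close>, with
    \<open>v = sqrt u\<close>. The iterated scaling law then determines all other layers.\<close>
  define \<omega> where "\<omega> u = f (\<theta> * sqrt u) / (\<theta> * k ^ 4 * sqrt u ^ 3)" for u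
  have pos: "u > 0" if "u > k powi (-4)" for u
    using that k by (smt (verit) zero_less_power_int)
  have iter: "f (\<theta> * (k powi (2 * m) * y)) = k powi (- 2 * m\<^sup>2) * y powi (- 2 * m) * f (\<theta> * y)"
    if "y > 0" for y m
    using scaling_iterate[where g = "\<lambda>x. f (\<theta> * x)", OF _ scal that] k by simp
  show "\<omega> \<in> borel_measurable (restrict_space borel {k powi (-4)<..1})"
  proof -
    have "(\<lambda>u. \<theta> * sqrt u) \<in> restrict_space borel {k powi (-4)<..1} \<rightarrow>\<^sub>M restrict_space borel {0<..}"
      using \<theta> pos by (intro measurable_restrict_space2 measurable_restrict_space1)
        (auto simp: space_restrict_space)
    from measurable_compose[OF this, of f borel] have
      "(\<lambda>u. f (\<theta> * sqrt u)) \<in> borel_measurable (restrict_space borel {k powi (-4)<..1})"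
      using dens by (simp add: pos_density_def)
    then show ?thesis unfolding \<omega>_def
      by (intro borel_measurable_divide) (auto intro!: measurable_restrict_space1)
  qed
  show "0 \<le> \<omega> u" if "u \<in> {k powi (-4)<..1}" for u
    using dens \<theta> k pos[of u] that by (simp add: \<omega>_def pos_density_def)
  show "f y = layer_sum \<theta> k \<omega> y" if "y > 0" for y
  proof -
    obtain m v where y: "y / \<theta> = k powi (2 * m) * v" and v: "k powi (-2) < v" "v \<le> 1" "v > 0"
      using layer_coords[OF k, of "y / \<theta>"] \<open>y > 0\<close> \<theta> by (metis divide_pos_pos)
    have y: "y = \<theta> * k powi (2 * m) * v" using y \<theta> by (simp add: field_simps)
    have "\<theta> * k powi (4 - 2 * m\<^sup>2) * v powi (3 - 2 * m) * \<omega> (v\<^sup>2)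
            = k powi (- 2 * m\<^sup>2) * v powi (- 2 * m) * f (\<theta> * v)"
      using k v \<theta> by (simp add: \<omega>_def power_int_diff power_int_minus field_simps)
    thus ?thesis
      unfolding y layer_sum_eval[OF k \<theta> v(1,2)] using iter[OF v(3), of m] by (simp add: mult.assoc)
  qed
  show "u * \<omega> u = 1 / (k ^ 4 * u) * \<omega> (1 / (k ^ 4 * u))" if "k powi (-4) < u" "u < 1" for u
  proof -
    define v where "v = sqrt u"
    have v: "v > 0" "u = v\<^sup>2" using pos[OF that(1)] by (auto simp: v_def)
    have s: "sqrt (1 / (k ^ 4 * u)) = 1 / (k\<^sup>2 * v)"
      using k v by (simp add: real_sqrt_mult real_sqrt_divide) (metis real_sqrt_unique zero_le_power2 power_mult mult_2 numeral_Bit0 numeral_One one_add_one)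
    \<comment> \<open>Reflection moves the point to \<open>k^2 * v\<close>, outside the base layer;
      one use of the scaling law brings it back to \<open>v\<close>. The resulting factor is the one
      relating the two values of \<open>u * \<omega> u\<close>.\<close>
    have "f (\<theta> * (1 / (k\<^sup>2 * v))) = f (\<theta> * (k\<^sup>2 * v))"
      using R k v(1) by (simp add: R_symmetric_def)
    also have "\<dots> = f (\<theta> * v) / (k\<^sup>2 * v\<^sup>2)"
      using scal[of v] v(1) k by (simp add: field_simps)
    finally have "f (\<theta> * (1 / (k\<^sup>2 * v))) = f (\<theta> * v) / (k\<^sup>2 * v\<^sup>2)" .
    thus ?thesis
      unfolding \<omega>_def s v_def[symmetric] using k v \<theta>
      by (simp add: field_simps eval_nat_numeral)
  qed
qed

theorem theorem1:
  fixes f :: "real \<Rightarrow> real" and \<delta> \<theta> k :: real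
  assumes "pos_density f"
    and "\<delta> > 0" and "\<theta> > 0"
    and "k = \<delta> / \<theta>"
  shows "doubly_symmetric f \<delta> \<theta> \<longleftrightarrow>
    k > 1 \<and>
    (\<exists>(C::real) (\<omega> :: real \<Rightarrow> real).
       C > 0 \<and>
       \<omega> \<in> borel_measurable (restrict_space borel {k powi (-4)<..1}) \<and>
       (\<forall>u\<in>{k powi (-4)<..1}. 0 \<le> \<omega> u) \<and>
       (\<forall>y>0. f y = C * (\<Sum>\<^sub>\<infinity>i::int.
          if \<theta> * k powi (-2 * i) < y \<and> y \<le> \<theta> * k powi (2 - 2 * i)
          then \<theta> powi (-2 * i) * k powi (2 * i * (i + 1)) * y powi (2 * i + 1)
                 * \<omega> (\<theta> powi (-2) * k powi (4 * (i - 1)) * y\<^sup>2)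
          else 0)) \<and>
       (let \<psi> = (\<lambda>u. u * \<omega> u) in
          \<forall>u. k powi (-4) < u \<and> u < 1 \<longrightarrow> \<psi> u = \<psi> (1 / (k ^ 4 * u))))"
proof -
  have k0: "k > 0" using assms by simp
  note iff = doubly_symmetric_iff_scaling[OF assms(2-4), of f]
  show ?thesis
    unfolding layer_sum_def[symmetric] Let_def
  proof (intro iffI; (elim conjE exE)?)
    assume "doubly_symmetric f \<delta> \<theta>"
    hence R: "R_symmetric f \<theta>"
      and scal: "\<And>x. x > 0 \<Longrightarrow> f (\<theta> * x) = k\<^sup>2 * x\<^sup>2 * f (\<theta> * (k\<^sup>2 * x))"
      using iff by auto
    have k1: "k > 1" by (rule scaling_density_gt_1[OF assms(1,3) k0 scal])
    obtain \<omega> where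
      "\<omega> \<in> borel_measurable (restrict_space borel {k powi (-4)<..1})"
      "\<And>u. u \<in> {k powi (-4)<..1} \<Longrightarrow> 0 \<le> \<omega> u"
      "\<And>y. y > 0 \<Longrightarrow> f y = layer_sum \<theta> k \<omega> y"
      "\<And>u. k powi (-4) < u \<Longrightarrow> u < 1 \<Longrightarrow> u * \<omega> u = 1 / (k ^ 4 * u) * \<omega> (1 / (k ^ 4 * u))"
      using symmetric_imp_representation[OF assms(1) k1 assms(3) R scal] by metis
    with k1 show "k > 1 \<and> (\<exists>C \<omega>. C > 0 \<and>
        \<omega> \<in> borel_measurable (restrict_space borel {k powi (-4)<..1}) \<and>
        (\<forall>u\<in>{k powi (-4)<..1}. 0 \<le> \<omega> u) \<and> (\<forall>y>0. f y = C * layer_sum \<theta> k \<omega> y) \<and>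
        (\<forall>u. k powi (-4) < u \<and> u < 1 \<longrightarrow> u * \<omega> u = 1 / (k ^ 4 * u) * \<omega> (1 / (k ^ 4 * u))))"
      \<comment> \<open>The constant can be 1 because \<omega> was read off from \<open>f\<close>
        itself and already carries its normalisation.\<close>
      by (intro conjI exI[of _ "1::real"] exI[of _ \<omega>]) auto
  next
    fix C :: real and \<omega> :: "real \<Rightarrow> real"
    assume "k > 1" "\<forall>y>0. f y = C * layer_sum \<theta> k \<omega> y"
      "\<forall>u. k powi (-4) < u \<and> u < 1 \<longrightarrow> u * \<omega> u = 1 / (k ^ 4 * u) * \<omega> (1 / (k ^ 4 * u))"
    then show "doubly_symmetric f \<delta> \<theta>"
      using representation_imp_symmetric[of k \<theta> f C \<omega>] assms(3) iff by auto
  qed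
qed

end
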